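(* Let $R$ be a commutative ring, let $a,q,\rho_1,\rho_2\in R$ with $q,\rho_1,\rho_2$ units, and suppose that for every $k\in\mathbb{N}$ the elements $(q;q)_k$, $(aq;q)_k$, $(aq/\rho_1;q)_k$ and $(aq/\rho_2;q)_k$ are units of $R$. Let $(\alpha_n,\beta_n)_{n\ge 0}$ be a Bailey pair with respect to $a$. Define, for $n\ge 0$, $$\alpha_n':=\frac{(\rho_1;q)_n(\rho_2;q)_n}{\left(\frac{aq}{\rho_1};q\right)_n\left(\frac{aq}{\rho_2};q\right)_n}\left(\frac{aq}{\rho_1\rho_2}\right)^n\alpha_n,$$ $$\beta_n':=\sum_{j=0}^{n}\frac{(\rho_1;q)_j(\rho_2;q)_j\left(\frac{aq}{\rho_1\rho_2};q\right)_{n-j}}{\left(\frac{aq}{\rho_1};q\right)_n\left(\frac{aq}{\rho_2};q\right)_n(q;q)_{n-j}}\left(\frac{aq}{\rho_1\rho_2}\right)^j\beta_j.$$ Then $(\alpha_n',\beta_n')_{n\ge 0}$ is also a Bailey pair with respect to $a$; that is, for all $n\ge 0$, $$\sum_{j=0}^{n}\frac{(\rho_1;q)_j(\rho_2;q)_j\left(\frac{aq}{\rho_1\rho_2};q\right)_{n-j}}{\left(\frac{aq}{\rho_1};q\right)_n\left(\frac{aq}{\rho_2};q\right)_n(q;q)_{n-j}}\left(\frac{aq}{\rho_1\rho_2}\right)^j\beta_j=\sum_{j=0}^{n}\frac{(\rho_1;q)_j(\rho_2;q)_j}{\left(\frac{aq}{\rho_1};q\right)_j\left(\frac{aq}{\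rho_2};q\right)_j(q;q)_{n-j}(aq;q)_{n+j}}\left(\frac{aq}{\rho_1\rho_2}\right)^j\alpha_j.$$
   Context: $\mathbb{N}$ contains $0$. The finite $q$-Pochhammer symbol is $(x;q)_n:=\prod_{i=0}^{n-1}(1-xq^i)$. Fractions denote multiplication by the inverse of a unit. Two sequences $(\alpha_n)_{n\ge0},(\beta_n)_{n\ge0}$ in $R$ form a Bailey pair with respect to $a$ if for all $n\ge 0$ $$\beta_n=\sum_{r=0}^{n}\frac{\alpha_r}{(q;q)_{n-r}(aq;q)_{n+r}}.$$ *)

theory Defs
  imports Main
begin

text \<open>
  The sort \<open>{comm_ring, comm_monoid_mult}\<close> describes commutative rings with \<open>1\<close>. Unlike
  \<open>comm_ring_1\<close> it does not require \<open>0 \<noteq> 1\<close>, so the zero ring is included.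
\<close>

definition unit_inv :: "'a::comm_monoid_mult \<Rightarrow> 'a"
  where "unit_inv u = (THE v. u * v = 1)"

text \<open>Specified only for a unit \<open>u\<close>, that is, for \<open>u dvd 1\<close>.\<close>
definition unit_div :: "'a::comm_monoid_mult \<Rightarrow> 'a \<Rightarrow> 'a"  (infixl "\<oslash>" 70)
  where "x \<oslash> u = x * unit_inv u"

lemma unit_inv_unique:
  fixes u v :: "'a::comm_monoid_mult"
  assumes "u * v = 1"
  shows "unit_inv u = v"
  unfolding unit_inv_def
proof (rule the_equality)
  show "u * v = 1" by (rule assms)
  fix w assume w: "u * w = 1"
  have "w = (u * v) * w" using assms by simp
  also have "\<dots> = v * (u * w)" by (simp add: ac_simps)
  finally show "w = v" using w by simp
qed

lemma unit_inv_right: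
  fixes u :: "'a::comm_monoid_mult"
  assumes "u dvd 1"
  shows "u * unit_inv u = 1"
proof -
  from assms obtain v where "u * v = 1" by (metis dvdE)
  then show ?thesis using unit_inv_unique by metis
qed

definition qpoch :: "'a::{comm_ring,comm_monoid_mult} \<Rightarrow> 'a \<Rightarrow> nat \<Rightarrow> 'a"
  where "qpoch x q n = (\<Prod>i<n. 1 - x * q ^ i)"

definition bailey_pair ::
  "'a::{comm_ring,comm_monoid_mult} \<Rightarrow> 'a \<Rightarrow> (nat \<Rightarrow> 'a) \<Rightarrow> (nat \<Rightarrow> 'a) \<Rightarrow> bool"
  where "bailey_pair a q \<alpha> \<beta> \<longleftrightarrow>
    (\<forall>n. \<beta> n = (\<Sum>r\<le>n. \<alpha> r \<oslash> (qpoch q q (n - r) * qpoch (a * q) q (n + r))))"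

end

(*
  Substituting the Bailey relation for beta_j into beta'_n and exchanging the sums, the coefficient of
  alpha_r becomes a terminating balanced 3phi2 in the shifted parameters rho_1 q^r, rho_2 q^r, which the
  q-Pfaff-Saalschuetz sum evaluates. With c = aq/(rho_1 rho_2), x = rho_1 q^r, y = rho_2 q^r that sum
  involves only c, x, y, q and the inverses of (q;q)_k:
    sum_i (x)_i (y)_i c^i (c)_{m-i} (cxy q^i)_{m-i} / ((q)_i (q)_{m-i}) = (cx)_m (cy)_m / (q)_m.
  It is proved by induction on m: the difference of (1 - q^{m+1}) times the (m+1)-st sum and
  (1 - cx q^m)(1 - cy q^m) times the m-th sum telescopes in i.
*)

theory Submission
  imports Defs
begin

section \<open>Inverses of units\<close>

lemma unit_inv_factor:
  fixes u v :: "'a::comm_monoid_mult"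
  assumes "u * v dvd 1"
  shows "unit_inv u = v * unit_inv (u * v)"
  by (rule unit_inv_unique) (use unit_inv_right[OF assms] in \<open>simp add: mult.assoc\<close>)

lemma unit_inv_mult:
  fixes u v :: "'a::comm_monoid_mult"
  assumes "u dvd 1" "v dvd 1"
  shows "unit_inv (u * v) = unit_inv u * unit_inv v"
proof (rule unit_inv_unique)
  have "(u * v) * (unit_inv u * unit_inv v) = (u * unit_inv u) * (v * unit_inv v)"
    by (simp only: ac_simps)
  then show "(u * v) * (unit_inv u * unit_inv v) = 1"
    by (simp add: unit_inv_right assms)
qed

lemma unit_mult:
  fixes u v :: "'a::comm_monoid_mult"
  assumes "u dvd 1" "v dvd 1"
  shows "u * v dvd 1"
  using mult_dvd_mono[OF assms] by simp

section \<open>q-Pochhammer symbols\<close>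

lemma qpoch_0 [simp]: "qpoch x q 0 = 1"
  by (simp add: qpoch_def)

lemma qpoch_Suc: "qpoch x q (Suc n) = qpoch x q n * (1 - x * q ^ n)"
  by (simp add: qpoch_def)

lemma qpoch_add: "qpoch x q (m + n) = qpoch x q m * qpoch (x * q ^ m) q n"
  by (induction n) (simp_all add: qpoch_Suc power_add ac_simps)

lemma qpoch_Suc_left: "qpoch x q (Suc n) = (1 - x) * qpoch (x * q) q n"
  using qpoch_add[of x q 1 n] by (simp add: qpoch_Suc)

text \<open>Replaces the inverse of a shorter symbol by that of a longer one, which puts summands
  over a common denominator.\<close>

lemma unit_inv_qpoch_add:
  assumes "qpoch x q (m + n) dvd 1"
  shows "unit_inv (qpoch x q m) = qpoch (x * q ^ m) q n * unit_inv (qpoch x q (m + n))"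
  using assms unit_inv_factor unfolding qpoch_add by blast

lemma unit_inv_qpoch_Suc:
  assumes "qpoch x q (Suc n) dvd 1"
  shows "unit_inv (qpoch x q n) = (1 - x * q ^ n) * unit_inv (qpoch x q (Suc n))"
  using assms unit_inv_factor unfolding qpoch_Suc by blast

section \<open>The q-Pfaff-Saalschuetz sum\<close>

text \<open>The inverses of \<open>(q;q)_i\<close> and \<open>(q;q)_d\<close> are left out, so the
  recurrences need no units. Having \<open>d\<close> in place of \<open>m - i\<close> keeps natural
  subtraction out of them.\<close>

definition saal_term :: "'a::{comm_ring,comm_monoid_mult} \<Rightarrow> 'a \<Rightarrow> 'a \<Rightarrow> 'a \<Rightarrow> nat \<Rightarrow> nat \<Rightarrow> 'a"
  where "saal_term q c x y i d =
    qpoch x q i * qpoch y q i * c ^ i * qpoch c q d * qpoch (c * x * y * q ^ i) q d"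

lemma saal_term_Suc_right:
  "saal_term q c x y i (Suc d) =
    saal_term q c x y i d * ((1 - c * q ^ d) * (1 - c * x * y * q ^ (i + d)))"
  by (simp add: saal_term_def qpoch_Suc power_add ac_simps)

text \<open>Cross-multiplied, because the factors on the left need not be units.\<close>

lemma saal_term_Suc_left:
  "saal_term q c x y (Suc i) d * ((1 - c * q ^ d) * (1 - c * x * y * q ^ i)) =
    saal_term q c x y i (Suc d) * (c * (1 - x * q ^ i) * (1 - y * q ^ i))"
proof -
  have "qpoch (c * x * y * q ^ i) q (Suc d) =
      (1 - c * x * y * q ^ i) * qpoch (c * x * y * q ^ Suc i) q d"
    by (simp add: qpoch_Suc_left ac_simps)
  then show ?thesis
    unfolding saal_term_def by (simp only: qpoch_Suc power_Suc) (simp only: ac_simps)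
qed

text \<open>The case \<open>X = q ^ i\<close>, \<open>Y = q ^ (m - i)\<close> is the telescoping step, with common factors removed.\<close>
lemma saal_certificate:
  fixes c q x y X Y :: "'a::{comm_ring,comm_monoid_mult}"
  shows "(1 - q * X * Y) * ((1 - c * Y) * (1 - c * x * y * (X * Y)))
    - (1 - q * Y) * ((1 - c * x * (X * Y)) * (1 - c * y * (X * Y)))
    = (1 - X) * ((1 - c * Y) * (q - c * x * y * X)) * Y
      - (1 - q * Y) * (c * (1 - x * X) * (1 - y * X) * Y)"
  by (simp add: algebra_simps)

text \<open>With \<open>m = k + d\<close>, this is the partial sum over \<open>i \<le> k\<close> of the telescoping difference; the
  second summand on the left is the boundary term.\<close>
lemma saal_telescope:
  fixes q c x y :: "'a::{comm_ring,comm_monoid_mult}"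
  assumes unit: "\<And>k. qpoch q q k dvd 1"
  defines "u \<equiv> \<lambda>k. unit_inv (qpoch q q k)"
  shows "(\<Sum>i\<le>k. u i * u (Suc (k + d) - i) * saal_term q c x y i (Suc (k + d) - i)) * (1 - q ^ Suc (k + d))
    + u k * u d * saal_term q c x y k d * (c * (1 - x * q ^ k) * (1 - y * q ^ k)) * q ^ d
    = (\<Sum>i\<le>k. u i * u (k + d - i) * saal_term q c x y i (k + d - i))
      * ((1 - c * x * q ^ (k + d)) * (1 - c * y * q ^ (k + d)))"
proof -
  have u_Suc: "u k = (1 - q * q ^ k) * u (Suc k)" for k
    unfolding u_def by (rule unit_inv_qpoch_Suc[OF unit])
  \<comment> \<open>The second summand on the left flows out of index \<open>i\<close>, the last one
    on the right flows in from the preceding index.\<close>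
  have step: "u i * u (Suc d) * saal_term q c x y i (Suc d) * (1 - q ^ Suc (i + d))
      + u i * u d * saal_term q c x y i d * (c * (1 - x * q ^ i) * (1 - y * q ^ i)) * q ^ d
      = u i * u d * saal_term q c x y i d * ((1 - c * x * q ^ (i + d)) * (1 - c * y * q ^ (i + d)))
      + u i * u (Suc d) * saal_term q c x y i d
        * ((1 - q ^ i) * ((1 - c * q ^ d) * (q - c * x * y * q ^ i)) * q ^ d)"
    for i d
  proof -
    \<comment> \<open>A common factor of all four summands of \<open>step\<close>; the cofactors are
      those of \<open>saal_certificate\<close>.\<close>
    let ?w = "u i * u (Suc d) * saal_term q c x y i d"
    have 1: "u i * u (Suc d) * saal_term q c x y i (Suc d) * (1 - q ^ Suc (i + d)) =
       ?w * ((1 - q * q ^ i * q ^ d) * ((1 - c * q ^ d) * (1 - c * x * y * (q ^ i * q ^ d))))"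
      unfolding saal_term_Suc_right power_Suc power_add by (simp only: ac_simps)
    have 2: "u i * u d * saal_term q c x y i d * z = ?w * ((1 - q * q ^ d) * z)" for z
      unfolding u_Suc[of d] by (simp only: ac_simps)
    have 3: "?w * A + ?w * B = ?w * C + ?w * D" if "A - C = D - B" for A B C D
    proof -
      have "A = (D - B) + C" unfolding that[symmetric] by simp
      then have "A + B = C + D" by (simp add: ac_simps)
      then show ?thesis unfolding distrib_left[symmetric] by simp
    qed
    show ?thesis
      unfolding 1 2 mult.assoc[of _ _ "q ^ d"] power_add
      using 3[OF saal_certificate[of q "q ^ i" "q ^ d" c x y]]
      by (simp only: mult.assoc)
  qed
  show ?thesis
  \<comment> \<open>The total \<open>k + d\<close> stays fixed along the sum, so the step to
    \<open>Suc k\<close> needs the hypothesis at \<open>Suc d\<close>.\<close>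
  proof (induction k arbitrary: d)
    case 0
    \<comment> \<open>Nothing flows in at index 0, by the factor \<open>1 - q ^ 0\<close>.\<close>
    show ?case using step[of 0 d] by simp
  next
    case (Suc k)
    \<comment> \<open>The inflow at \<open>Suc k\<close> is the outflow at \<open>k\<close>:
      \<open>u (Suc k)\<close> absorbs \<open>1 - q ^ Suc k\<close>, and a factor \<open>q\<close>
      raises \<open>q ^ d\<close> to \<open>q ^ Suc d\<close>.\<close>
    have link: "u (Suc k) * u (Suc d) * saal_term q c x y (Suc k) d
        * ((1 - q ^ Suc k) * ((1 - c * q ^ d) * (q - c * x * y * q ^ Suc k)) * q ^ d)
      = u k * u (Suc d) * saal_term q c x y k (Suc d) * (c * (1 - x * q ^ k) * (1 - y * q ^ k)) * q ^ Suc d"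
    proof -
      have q: "q - c * x * y * q ^ Suc k = q * (1 - c * x * y * q ^ k)"
        by (simp add: algebra_simps)
      have "u (Suc k) * u (Suc d) * saal_term q c x y (Suc k) d
        * ((1 - q ^ Suc k) * ((1 - c * q ^ d) * (q - c * x * y * q ^ Suc k)) * q ^ d)
       = ((1 - q * q ^ k) * u (Suc k)) * u (Suc d) *
         (saal_term q c x y (Suc k) d * ((1 - c * q ^ d) * (1 - c * x * y * q ^ k))) * q ^ Suc d"
        unfolding q unfolding power_Suc by (simp only: ac_simps)
      also have "\<dots> = u k * u (Suc d) * saal_term q c x y k (Suc d) * (c * (1 - x * q ^ k) * (1 - y * q ^ k)) * q ^ Suc d"
        unfolding saal_term_Suc_left u_Suc[symmetric] by (simp only: ac_simps)
      finally show ?thesis .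
    qed
    have sub: "Suc (Suc k + d) - Suc k = Suc d" "Suc k + d - Suc k = d" "k + Suc d = Suc k + d" by simp_all
    \<comment> \<open>Here \<open>g\<close> is the boundary term at \<open>k\<close>; adding the two
      equations removes it.\<close>
    have cancel: "(s + t) * z + g' = (s' + t') * z'"
      if "s * z + g = s' * z'" "t * z + g' = t' * z' + g" for s t z g g' s' t' z' :: 'a
      using that by (simp add: distrib_right) (metis add.assoc add.commute)
    show ?case
      unfolding sum.atMost_Suc sub(1,2)
      by (rule cancel[OF Suc.IH[of "Suc d", unfolded sub(3)] step[of "Suc k" d, unfolded link]])
  qed
qed

theorem q_pfaff_saalschuetz:
  fixes q c x y :: "'a::{comm_ring,comm_monoid_mult}"
  assumes unit: "\<And>k. qpoch q q k dvd 1"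
  shows "(\<Sum>i\<le>m. unit_inv (qpoch q q i) * unit_inv (qpoch q q (m - i)) * saal_term q c x y i (m - i))
    = unit_inv (qpoch q q m) * qpoch (c * x) q m * qpoch (c * y) q m"
proof (induction m)
  case 0
  have "unit_inv (1::'a) = 1" by (rule unit_inv_unique) simp
  then show ?case by (simp add: saal_term_def)
next
  case (Suc m)
  define u where "u k = unit_inv (qpoch q q k)" for k
  define S where "S m = (\<Sum>i\<le>m. u i * u (m - i) * saal_term q c x y i (m - i))" for m
  have u_Suc: "u k = (1 - q * q ^ k) * u (Suc k)" for k
    unfolding u_def by (rule unit_inv_qpoch_Suc[OF unit])
  have u0: "u 0 = 1" unfolding u_def by (rule unit_inv_unique) simp
  have IH: "S m = u m * qpoch (c * x) q m * qpoch (c * y) q m"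
    using Suc.IH by (simp add: S_def u_def)
  have "S (Suc m) = (\<Sum>i\<le>m. u i * u (Suc m - i) * saal_term q c x y i (Suc m - i))
      + u (Suc m) * saal_term q c x y (Suc m) 0"
    by (simp add: S_def u0)
  \<comment> \<open>The top summand of the new sum supplies exactly the boundary term of
    \<open>saal_telescope\<close> at \<open>k = m\<close>, \<open>d = 0\<close>.\<close>
  moreover have "u (Suc m) * saal_term q c x y (Suc m) 0 * (1 - q ^ Suc m) =
     u m * u 0 * saal_term q c x y m 0 * (c * (1 - x * q ^ m) * (1 - y * q ^ m)) * q ^ 0"
    unfolding u_Suc[of m] u0 by (simp add: saal_term_def qpoch_Suc) (simp only: ac_simps)
  ultimately have "S (Suc m) * (1 - q ^ Suc m) = S m * ((1 - c * x * q ^ m) * (1 - c * y * q ^ m))"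
    using saal_telescope[OF unit, where k=m and d=0 and c=c and x=x and y=y]
    by (simp add: u_def[symmetric] S_def[symmetric] distrib_right u0 del: qpoch_0)
  then have eq: "S (Suc m) * (1 - q ^ Suc m) = u m * qpoch (c * x) q (Suc m) * qpoch (c * y) q (Suc m)"
    unfolding IH qpoch_Suc by (simp only: ac_simps)
  \<comment> \<open>As a factor of \<open>(q;q)_(m+1)\<close>, \<open>1 - q ^ Suc m\<close> is a
    unit and can be cancelled from \<open>eq\<close>.\<close>
  have one: "(1 - q ^ Suc m) * (u (Suc m) * qpoch q q m) = 1"
    using unit_inv_right[OF unit[of "Suc m"]] unfolding qpoch_Suc[of q q m] u_def power_Suc
    by (simp only: ac_simps)
  have one': "u m * qpoch q q m = 1"
    using unit_inv_right[OF unit[of m]] unfolding u_def by (simp only: ac_simps)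
  have "S (Suc m) = S (Suc m) * (1 - q ^ Suc m) * (u (Suc m) * qpoch q q m)"
    using one by (simp only: mult.assoc mult_1_right)
  also have "\<dots> = (u m * qpoch q q m) * (u (Suc m) * qpoch (c * x) q (Suc m) * qpoch (c * y) q (Suc m))"
    unfolding eq by (simp only: ac_simps)
  finally show ?case unfolding one' by (simp add: S_def u_def)
qed

section \<open>The coefficient of \<open>\<alpha> r\<close> and the Bailey transform\<close>

text \<open>The coefficient of \<open>\<alpha> r\<close> in \<open>\<beta>' n\<close> for
  \<open>n = r + m\<close>, \<open>j = r + i\<close>, with \<open>x\<close>, \<open>y\<close> for
  \<open>\<rho>\<^sub>1\<close>, \<open>\<rho>\<^sub>2\<close>. In terms of \<open>c\<close> no
  inverse of these occurs.\<close>

lemma bailey_kernel: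
  fixes c q x y :: "'a::{comm_ring,comm_monoid_mult}"
  assumes unit: "\<And>k. qpoch q q k dvd 1" "\<And>k. qpoch (c * x * y) q k dvd 1"
    "\<And>k. qpoch (c * x) q k dvd 1" "\<And>k. qpoch (c * y) q k dvd 1"
  shows "(\<Sum>i\<le>m. qpoch x q (r + i) * qpoch y q (r + i) * qpoch c q (m - i)
        * (unit_inv (qpoch (c * y) q (r + m)) * unit_inv (qpoch (c * x) q (r + m)) * unit_inv (qpoch q q (m - i)))
        * c ^ (r + i) * (unit_inv (qpoch q q i) * unit_inv (qpoch (c * x * y) q (r + i + r))))
    = qpoch x q r * qpoch y q r * (unit_inv (qpoch (c * y) q r) * unit_inv (qpoch (c * x) q r)
        * unit_inv (qpoch q q m) * unit_inv (qpoch (c * x * y) q (r + m + r))) * c ^ r"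
    (is "(\<Sum>i\<le>m. ?f i) = ?rhs")
proof -
  let ?X = "x * q ^ r" and ?Y = "y * q ^ r"
  let ?k = "qpoch x q r * qpoch y q r * c ^ r * unit_inv (qpoch (c * y) q (r + m))
    * unit_inv (qpoch (c * x) q (r + m)) * unit_inv (qpoch (c * x * y) q (r + m + r))"
  have "?f i = ?k * (unit_inv (qpoch q q i) * unit_inv (qpoch q q (m - i)) * saal_term q c ?X ?Y i (m - i))"
    if "i \<le> m" for i
  proof -
    have idx: "r + i + r + (m - i) = r + m + r" using that by simp
    have "c * x * y * q ^ (r + i + r) = c * ?X * ?Y * q ^ i"
      unfolding power_add by (simp only: ac_simps)
    \<comment> \<open>The new denominator is independent of \<open>i\<close>; the numerator is the
      last factor of \<open>saal_term\<close> at \<open>?X\<close>, \<open>?Y\<close>.\<close>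
    then have inv: "unit_inv (qpoch (c * x * y) q (r + i + r)) =
        qpoch (c * ?X * ?Y * q ^ i) q (m - i) * unit_inv (qpoch (c * x * y) q (r + m + r))"
      using unit_inv_qpoch_add[OF unit(2), of "r + i + r" "m - i"] unfolding idx by simp
    show ?thesis
      unfolding inv saal_term_def qpoch_add[of x q r i] qpoch_add[of y q r i] power_add[of c]
      by (simp only: ac_simps)
  qed
  then have "(\<Sum>i\<le>m. ?f i) = ?k * (unit_inv (qpoch q q m) * qpoch (c * ?X) q m * qpoch (c * ?Y) q m)"
    by (simp add: q_pfaff_saalschuetz[OF unit(1), symmetric] sum_distrib_left)
  also have "\<dots> = ?rhs"
    unfolding unit_inv_qpoch_add[OF unit(3), of r m] unit_inv_qpoch_add[OF unit(4), of r m]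
    by (simp only: ac_simps)
  finally show ?thesis .
qed

text \<open>Indexing by \<open>r\<close> and \<open>j - r\<close> makes the inner sum start at 0, as
  \<open>bailey_kernel\<close> requires.\<close>

lemma sum_triangle_swap:
  fixes f :: "nat \<Rightarrow> nat \<Rightarrow> 'a::comm_monoid_add"
  shows "(\<Sum>j\<le>n. \<Sum>r\<le>j. f r (j - r)) = (\<Sum>r\<le>n. \<Sum>i\<le>n - r. f r i)"
proof -
  have "(\<Sum>j\<le>n. \<Sum>r\<le>j. f r (j - r)) = (\<Sum>(r, i)\<in>{(r, i). r + i \<le> n}. f r i)"
    by (rule sum.triangle_reindex_eq[symmetric])
  also have "{(r, i). r + i \<le> n} = Sigma {..n} (\<lambda>r. {..n - r})" by auto
  finally show ?thesis by (simp add: sum.Sigma)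
qed

theorem lemma3p6p1:
  fixes a q \<rho>\<^sub>1 \<rho>\<^sub>2 :: "'a::{comm_ring,comm_monoid_mult}"
    and \<alpha> \<beta> \<alpha>' \<beta>' :: "nat \<Rightarrow> 'a"
  assumes "q dvd 1" and "\<rho>\<^sub>1 dvd 1" and "\<rho>\<^sub>2 dvd 1"
    and "\<And>k. qpoch q q k dvd 1"
    and "\<And>k. qpoch (a * q) q k dvd 1"
    and "\<And>k. qpoch (a * q \<oslash> \<rho>\<^sub>1) q k dvd 1"
    and "\<And>k. qpoch (a * q \<oslash> \<rho>\<^sub>2) q k dvd 1"
    and "bailey_pair a q \<alpha> \<beta>"
    and "\<And>n. \<alpha>' n =
      (qpoch \<rho>\<^sub>1 q n * qpoch \<rho>\<^sub>2 q n)
        \<oslash> (qpoch (a * q \<oslash> \<rho>\<^sub>1) q n * qpoch (a * q \<oslash> \<rho>\<^sub>2) q n)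
        * (a * q \<oslash> (\<rho>\<^sub>1 * \<rho>\<^sub>2)) ^ n * \<alpha> n"
    and "\<And>n. \<beta>' n =
      (\<Sum>j\<le>n. (qpoch \<rho>\<^sub>1 q j * qpoch \<rho>\<^sub>2 q j * qpoch (a * q \<oslash> (\<rho>\<^sub>1 * \<rho>\<^sub>2)) q (n - j))
        \<oslash> (qpoch (a * q \<oslash> \<rho>\<^sub>1) q n * qpoch (a * q \<oslash> \<rho>\<^sub>2) q n * qpoch q q (n - j))
        * (a * q \<oslash> (\<rho>\<^sub>1 * \<rho>\<^sub>2)) ^ j * \<beta> j)"
  shows "bailey_pair a q \<alpha>' \<beta>' \<and>
    (\<forall>n.
      (\<Sum>j\<le>n. (qpoch \<rho>\<^sub>1 q j * qpoch \<rho>\<^sub>2 q j * qpoch (a * q \<oslash> (\<rho>\<^sub>1 * \<rho>\<^sub>2)) q (n - j))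
        \<oslash> (qpoch (a * q \<oslash> \<rho>\<^sub>1) q n * qpoch (a * q \<oslash> \<rho>\<^sub>2) q n * qpoch q q (n - j))
        * (a * q \<oslash> (\<rho>\<^sub>1 * \<rho>\<^sub>2)) ^ j * \<beta> j)
      = (\<Sum>j\<le>n. (qpoch \<rho>\<^sub>1 q j * qpoch \<rho>\<^sub>2 q j)
        \<oslash> (qpoch (a * q \<oslash> \<rho>\<^sub>1) q j * qpoch (a * q \<oslash> \<rho>\<^sub>2) q j
            * qpoch q q (n - j) * qpoch (a * q) q (n + j))
        * (a * q \<oslash> (\<rho>\<^sub>1 * \<rho>\<^sub>2)) ^ j * \<alpha> j))"
proof -
  let ?c = "a * q \<oslash> (\<rho>\<^sub>1 * \<rho>\<^sub>2)"
  let ?D = "a * q \<oslash> \<rho>\<^sub>1" and ?E = "a * q \<oslash> \<rho>\<^sub>2"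
  note unit = assms(4-7)
  note inv_mult = unit_inv_mult unit_mult unit
  have r1: "\<rho>\<^sub>1 * unit_inv \<rho>\<^sub>1 = 1" and r2: "\<rho>\<^sub>2 * unit_inv \<rho>\<^sub>2 = 1"
    using assms(2,3) by (simp_all add: unit_inv_right)
  have c: "?c = a * q * (unit_inv \<rho>\<^sub>1 * unit_inv \<rho>\<^sub>2)"
    using assms(2,3) by (simp add: unit_div_def unit_inv_mult)
  have "?c * \<rho>\<^sub>1 = a * q * unit_inv \<rho>\<^sub>2 * (\<rho>\<^sub>1 * unit_inv \<rho>\<^sub>1)"
    unfolding c by (simp only: ac_simps)
  then have cx: "?E = ?c * \<rho>\<^sub>1" unfolding r1 by (simp add: unit_div_def)
  have "?c * \<rho>\<^sub>2 = a * q * unit_inv \<rho>\<^sub>1 * (\<rho>\<^sub>2 * unit_inv \<rho>\<^sub>2)"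
    unfolding c by (simp only: ac_simps)
  then have cy: "?D = ?c * \<rho>\<^sub>2" unfolding r2 by (simp add: unit_div_def)
  have "?c * \<rho>\<^sub>1 * \<rho>\<^sub>2 = a * q * (\<rho>\<^sub>1 * unit_inv \<rho>\<^sub>1) * (\<rho>\<^sub>2 * unit_inv \<rho>\<^sub>2)"
    unfolding c by (simp only: ac_simps)
  then have cxy: "a * q = ?c * \<rho>\<^sub>1 * \<rho>\<^sub>2" unfolding r1 r2 by simp
  have \<beta>: "\<beta> j = (\<Sum>r\<le>j. \<alpha> r * (unit_inv (qpoch q q (j - r)) * unit_inv (qpoch (a * q) q (j + r))))" for j
    using assms(8) unfolding bailey_pair_def by (simp add: unit_div_def inv_mult)
  define g where "g n j = qpoch \<rho>\<^sub>1 q j * qpoch \<rho>\<^sub>2 q j * qpoch ?c q (n - j)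
        * (unit_inv (qpoch ?D q n) * unit_inv (qpoch ?E q n) * unit_inv (qpoch q q (n - j)))
        * ?c ^ j" for n j
  define h where "h n r = qpoch \<rho>\<^sub>1 q r * qpoch \<rho>\<^sub>2 q r
        * (unit_inv (qpoch ?D q r) * unit_inv (qpoch ?E q r) * unit_inv (qpoch q q (n - r))
            * unit_inv (qpoch (a * q) q (n + r))) * ?c ^ r" for n r
  have kernel: "(\<Sum>i\<le>n - r. g n (r + i) * (unit_inv (qpoch q q i) * unit_inv (qpoch (a * q) q (r + i + r)))) = h n r"
    if le: "r \<le> n" for n r
  proof -
    obtain m where n: "n = r + m" using le_Suc_ex[OF le] by blast
    have "\<And>k. qpoch (?c * \<rho>\<^sub>1 * \<rho>\<^sub>2) q k dvd 1" "\<And>k. qpoch (?c * \<rho>\<^sub>1) q k dvd 1"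
      "\<And>k. qpoch (?c * \<rho>\<^sub>2) q k dvd 1"
      \<comment> \<open>\<open>cxy\<close> goes first, since \<open>?c * \<rho>\<^sub>1\<close> is a
        subterm of its right-hand side.\<close>
      unfolding cxy[symmetric] unfolding cx[symmetric] cy[symmetric] by (rule unit)+
    from bailey_kernel[OF unit(1) this, of r m, folded cxy, folded cx cy]
    show ?thesis
      unfolding g_def h_def n by simp
  qed
  have sums: "(\<Sum>j\<le>n. g n j * \<beta> j) = (\<Sum>r\<le>n. h n r * \<alpha> r)" for n
  proof -
    have "(\<Sum>j\<le>n. g n j * \<beta> j) = (\<Sum>j\<le>n. \<Sum>r\<le>j. \<alpha> r * (g n (r + (j - r))
        * (unit_inv (qpoch q q (j - r)) * unit_inv (qpoch (a * q) q (r + (j - r) + r)))))"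
      unfolding \<beta> sum_distrib_left by (intro sum.cong refl) (simp add: ac_simps)
    also have "\<dots> = (\<Sum>r\<le>n. \<Sum>i\<le>n - r. \<alpha> r * (g n (r + i)
        * (unit_inv (qpoch q q i) * unit_inv (qpoch (a * q) q (r + i + r)))))"
      by (rule sum_triangle_swap)
    also have "\<dots> = (\<Sum>r\<le>n. h n r * \<alpha> r)"
      unfolding sum_distrib_left[symmetric] by (intro sum.cong refl) (simp add: kernel mult.commute)
    finally show ?thesis .
  qed
  have \<alpha>': "\<alpha>' r \<oslash> (qpoch q q (n - r) * qpoch (a * q) q (n + r)) = h n r * \<alpha> r" for n r
    \<comment> \<open>The instances open only the outer quotients and leave \<open>?c\<close>,
      \<open>?D\<close>, \<open>?E\<close> intact.\<close>
    unfolding assms(9) h_def unit_div_def[of "qpoch _ _ _ * _"] unit_div_def[of "_ * \<alpha> r"]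
    by (simp add: inv_mult) (simp only: ac_simps)
  have lhs: "(qpoch \<rho>\<^sub>1 q j * qpoch \<rho>\<^sub>2 q j * qpoch ?c q (n - j))
        \<oslash> (qpoch ?D q n * qpoch ?E q n * qpoch q q (n - j)) * ?c ^ j = g n j" for n j
    unfolding g_def unit_div_def[of "_ * qpoch _ _ _"] by (simp add: inv_mult)
  have rhs: "(qpoch \<rho>\<^sub>1 q j * qpoch \<rho>\<^sub>2 q j)
        \<oslash> (qpoch ?D q j * qpoch ?E q j * qpoch q q (n - j) * qpoch (a * q) q (n + j)) * ?c ^ j = h n j" for n j
    unfolding h_def unit_div_def[of "_ * qpoch _ _ _"] by (simp add: inv_mult)
  show ?thesis
    unfolding bailey_pair_def assms(10) \<alpha>' lhs rhs by (simp add: sums)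
qed

end
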